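(* Let $p$ be an odd prime, $r\ge1$, and let $z^i\sigma$ be an element of $K(p^r)$. Put $\alpha=v_p(\sigma-1)$ and $\beta=v_p(i)$ (both in $\{0,\dots,r\}$). Then the conjugacy class of $z^i\sigma$ in $K(p^r)$ is $$[z^i\sigma]=\begin{cases}\{z^j\sigma: v_p(j)=\beta\} & \text{if } 0\le\beta<\alpha,\\ \{z^j\sigma: v_p(j)\ge\alpha\} & \text{if } \alpha\le\beta.\end{cases}$$
   Context: $K(p^r)$ is the group of elements $z^j\sigma$ with $j\in\mathbb{Z}/p^r\mathbb{Z}$, $\sigma\in(\mathbb{Z}/p^r\mathbb{Z})^*$ and multiplication $z^i\sigma\,z^j\tau=z^{i+\sigma j}\sigma\tau$. For $x\in\mathbb{Z}/p^r\mathbb{Z}$, $v_p(x)\in\{0,\dots,r\}$ is the $p$-adic valuation of a representative, with $v_p(0)=r$. *)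

theory Defs
  imports "HOL-Number_Theory.Residues"
begin

text \<open>
  The holomorph of \<open>\<int>/n\<int>\<close>: the pair \<open>(i, \<sigma>)\<close>
  encodes \<open>z\<^sup>i \<sigma>\<close>. Residue classes are represented by
  \<open>{0..n-1}\<close>; for \<open>n = 1\<close> the library's \<open>residue_ring\<close> is degenerate.
\<close>

definition K :: "int \<Rightarrow> (int \<times> int) monoid" where
  "K n = \<lparr>carrier = carrier (residue_ring n) \<times> Units (residue_ring n),
          monoid.mult = \<lambda>(i, \<sigma>) (j, \<tau>).
            (i \<oplus>\<^bsub>residue_ring n\<^esub> (\<sigma> \<otimes>\<^bsub>residue_ring n\<^esub> j), \<sigma> \<otimes>\<^bsub>residue_ring n\<^esub> \<tau>),
          one = (\<zero>\<^bsub>residue_ring n\<^esub>, \<one>\<^bsub>residue_ring n\<^esub>)\<rparr>"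

lemma group_K:
  assumes "n > 1"
  shows "group (K n)"
proof -
  define R where "R = residue_ring n"
  interpret residues n "residue_ring n"
    by unfold_locales (use assms in auto)
  interpret R: cring R
    unfolding R_def by (rule is_cring)
  have K_eq: "K n = \<lparr>carrier = carrier R \<times> Units R,
     monoid.mult = \<lambda>(i, \<sigma>) (j, \<tau>). (i \<oplus>\<^bsub>R\<^esub> \<sigma> \<otimes>\<^bsub>R\<^esub> j, \<sigma> \<otimes>\<^bsub>R\<^esub> \<tau>), one = (\<zero>\<^bsub>R\<^esub>, \<one>\<^bsub>R\<^esub>)\<rparr>"
    by (simp add: K_def R_def)
  show ?thesis
  proof (rule groupI, goal_cases)
    case (1 x y)
    then show ?case by (auto simp: K_eq R.Units_closed)
  next
    case 2
    then show ?case by (auto simp: K_eq)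
  next
    case (3 x y z)
    then show ?case
      by (auto simp: K_eq R.Units_closed R.r_distr R.m_assoc R.a_assoc)
  next
    case (4 x)
    then show ?case by (auto simp: K_eq R.Units_closed)
  next
    case (5 x)
    then obtain i \<sigma> where x: "x = (i, \<sigma>)" "i \<in> carrier R" "\<sigma> \<in> Units R"
      by (auto simp: K_eq)
    have "(\<ominus>\<^bsub>R\<^esub> (inv\<^bsub>R\<^esub> \<sigma> \<otimes>\<^bsub>R\<^esub> i), inv\<^bsub>R\<^esub> \<sigma>) \<in> carrier (K n)"
      using x by (auto simp: K_eq R.Units_closed)
    moreover have "(\<ominus>\<^bsub>R\<^esub> (inv\<^bsub>R\<^esub> \<sigma> \<otimes>\<^bsub>R\<^esub> i), inv\<^bsub>R\<^esub> \<sigma>) \<otimes>\<^bsub>K n\<^esub> x = \<one>\<^bsub>K n\<^esub>"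
      using x by (auto simp: K_eq R.Units_closed R.l_neg)
    ultimately show ?case by blast
  qed
qed

definition conjugacy_class :: "('a, 'b) monoid_scheme \<Rightarrow> 'a \<Rightarrow> 'a set" where
  "conjugacy_class G x = {g \<otimes>\<^bsub>G\<^esub> x \<otimes>\<^bsub>G\<^esub> inv\<^bsub>G\<^esub> g | g. g \<in> carrier G}"

text \<open>
  The \<open>p\<close>-adic valuation on \<open>\<int>/p\<^sup>r\<int>\<close>, as a function of an
  arbitrary integer representative. The case distinction is needed because
  \<open>multiplicity p 0 = 0\<close>.
\<close>

definition res_val :: "nat \<Rightarrow> nat \<Rightarrow> int \<Rightarrow> nat" where
  "res_val p r x = (if int p ^ r dvd x then r else multiplicity (int p) x)"

lemma res_val_le: "res_val p r x \<le> r"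
  unfolding res_val_def by (metis linorder_le_cases multiplicity_dvd' order_refl)

lemma dvd_iff_le_res_val:
  assumes "prime p" "k \<le> r"
  shows "int p ^ k dvd x \<longleftrightarrow> k \<le> res_val p r x"
proof (cases "int p ^ r dvd x")
  case True
  then show ?thesis
    using assms by (auto simp: res_val_def intro: dvd_trans[OF le_imp_power_dvd])
next
  case False
  then have "x \<noteq> 0" by auto
  moreover have "\<not> is_unit (int p)"
    using assms(1) not_prime_unit prime_nat_int_transfer by blast
  ultimately show ?thesis
    using False by (simp add: res_val_def power_dvd_iff_le_multiplicity)
qed

lemma res_val_cong:
  assumes "prime p" "[x = y] (mod int p ^ r)"
  shows "res_val p r x = res_val p r y"
proof -
  have "k \<le> res_val p r x \<longleftrightarrow> k \<le> res_val p r y" if "k \<le> r" for k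
    using that assms cong_dvd_iff cong_dvd_modulus le_imp_power_dvd
    by (metis dvd_iff_le_res_val)
  then show ?thesis
    using res_val_le by (metis order_antisym order_refl)
qed

end

theory Submission
  imports Defs
begin

text \<open>
  Solving \<open>y g = g x\<close> for \<open>x = z\<^sup>i \<sigma>\<close> and \<open>g = z\<^sup>k \<tau>\<close>, the conjugates of \<open>x\<close> are the
  \<open>z\<^sup>j \<sigma>\<close> with \<open>j = \<tau> i - (\<sigma> - 1) k\<close>. So \<open>j\<close> ranges over the unit multiples of \<open>i\<close> modulo
  the ideal generated by \<open>\<sigma> - 1\<close>, i.e. modulo \<open>p\<^sup>\<alpha>\<close>. If \<open>\<beta> < \<alpha>\<close>, unit multiples with \<open>k = 0\<close>
  already give all residues of valuation \<open>\<beta>\<close>; otherwise \<open>\<tau> = 1\<close> already gives the whole ideal.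
\<close>

text \<open>Multiplying by \<open>g\<close> on the right removes \<open>inv g\<close>, so inverses
  in \<open>K n\<close> never have to be computed.\<close>

lemma (in group) mem_conjugacy_class_iff:
  assumes "x \<in> carrier G"
  shows "y \<in> conjugacy_class G x \<longleftrightarrow>
    y \<in> carrier G \<and> (\<exists>g\<in>carrier G. y \<otimes> g = g \<otimes> x)"
proof -
  have "y = g \<otimes> x \<otimes> inv g \<longleftrightarrow> y \<otimes> g = g \<otimes> x"
    if "g \<in> carrier G" "y \<in> carrier G" for g
    using that assms by (metis inv_solve_right m_closed)
  then show ?thesis
    using assms unfolding conjugacy_class_def by blast
qed

lemma carrier_K:
  assumes "n > 1"
  shows "carrier (K n) = {0..n - 1} \<times> {\<sigma>. 0 < \<sigma> \<and> \<sigma> < n \<and> coprime \<sigma> n}"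
proof -
  interpret residues n "residue_ring n"
    by unfold_locales (use assms in auto)
  show ?thesis
    by (simp add: K_def res_units_eq res_carrier_eq)
qed

lemma mult_K:
  "(i, \<sigma>) \<otimes>\<^bsub>K n\<^esub> (j, \<tau>) = ((i + \<sigma> * j) mod n, (\<sigma> * \<tau>) mod n)"
  by (simp add: K_def residue_ring_def mod_simps)

text \<open>Comparing second components in \<open>y g = g x\<close> and cancelling the unit \<tau>
  forces \<open>\<rho> = \<sigma>\<close>; the first components give the congruence. Letting
  \<open>k\<close> and \<tau> be arbitrary integers spares later witnesses any reduction mod
  \<open>n\<close>.\<close>

lemma mem_conjugacy_class_K_iff:
  assumes n: "n > 1" and x: "(i, \<sigma>) \<in> carrier (K n)"
  shows "(j, \<rho>) \<in> conjugacy_class (K n) (i, \<sigma>) \<longleftrightarrow>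
    \<rho> = \<sigma> \<and> j \<in> {0..n - 1} \<and> (\<exists>k \<tau>. coprime \<tau> n \<and> [j = \<tau> * i - (\<sigma> - 1) * k] (mod n))"
    (is "?L \<longleftrightarrow> ?R")
proof -
  interpret group "K n"
    using n by (rule group_K)
  have eq_iff: "(j, \<sigma>) \<otimes>\<^bsub>K n\<^esub> (k, \<tau>) = (k, \<tau>) \<otimes>\<^bsub>K n\<^esub> (i, \<sigma>) \<longleftrightarrow>
      [j = \<tau> * i - (\<sigma> - 1) * k] (mod n)" for k \<tau>
  proof -
    have "j - (\<tau> * i - (\<sigma> - 1) * k) = (j + \<sigma> * k) - (k + \<tau> * i)"
      by (simp add: algebra_simps)
    then have "[j = \<tau> * i - (\<sigma> - 1) * k] (mod n) \<longleftrightarrow> [j + \<sigma> * k = k + \<tau> * i] (mod n)"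
      by (simp only: cong_iff_dvd_diff)
    then show ?thesis
      by (simp add: mult_K cong_def mult.commute)
  qed
  show ?thesis
  proof
    assume ?L
    then obtain k \<tau> where y: "(j, \<rho>) \<in> carrier (K n)" and g: "(k, \<tau>) \<in> carrier (K n)"
      and eq: "(j, \<rho>) \<otimes>\<^bsub>K n\<^esub> (k, \<tau>) = (k, \<tau>) \<otimes>\<^bsub>K n\<^esub> (i, \<sigma>)"
      using mem_conjugacy_class_iff[OF x] by auto
    have "[\<rho> * \<tau> = \<sigma> * \<tau>] (mod n)" "coprime \<tau> n"
      using eq g n by (auto simp: mult_K cong_def carrier_K mult.commute)
    then have "[\<rho> = \<sigma>] (mod n)"
      by (simp add: cong_mult_rcancel)
    then have "\<rho> = \<sigma>"
      using x y n by (auto simp: cong_def carrier_K)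
    moreover have "j \<in> {0..n - 1}"
      using y n by (simp add: carrier_K)
    ultimately show ?R
      using eq eq_iff \<open>coprime \<tau> n\<close> by blast
  next
    assume ?R
    then obtain k \<tau> where \<rho>: "\<rho> = \<sigma>" and j: "j \<in> {0..n - 1}" and \<tau>: "coprime \<tau> n"
      and c: "[j = \<tau> * i - (\<sigma> - 1) * k] (mod n)"
      by blast
    have "coprime (\<tau> mod n) n"
      using \<tau> n by simp
    \<comment> \<open>0 is coprime only to units, and \<open>n > 1\<close>.\<close>
    then have "\<tau> mod n \<noteq> 0"
      using n by auto
    then have "0 < \<tau> mod n"
      using n pos_mod_sign[of n \<tau>] by linarith
    then have "(k mod n, \<tau> mod n) \<in> carrier (K n)"
      using n \<open>coprime (\<tau> mod n) n\<close> by (simp add: carrier_K)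
    moreover have "[j = (\<tau> mod n) * i - (\<sigma> - 1) * (k mod n)] (mod n)"
      using c by (rule cong_trans) (intro cong_diff cong_mult; simp add: cong_def)
    moreover have "(j, \<sigma>) \<in> carrier (K n)"
      using j x n by (simp add: carrier_K)
    ultimately show ?L
      unfolding \<rho> using mem_conjugacy_class_iff[OF x] eq_iff by blast
  qed
qed

text \<open>Below the cap \<open>r\<close> the exponent \<open>Suc ?k\<close> is still at most
  \<open>r\<close>, so it can be tested by \<open>dvd_iff_le_res_val\<close>; its failure makes the
  cofactor prime to \<open>p\<close>.\<close>

lemma res_val_less_decompose:
  assumes "prime p" "res_val p r x < r"
  obtains u where "x = int p ^ res_val p r x * u" "coprime u (int p ^ r)"
proof -
  let ?k = "res_val p r x"
  obtain u where u: "x = int p ^ ?k * u"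
    using dvd_iff_le_res_val[OF assms(1), of ?k r x] assms(2) by (auto elim: dvdE)
  have "\<not> int p ^ Suc ?k dvd x"
    using dvd_iff_le_res_val[OF assms(1), of "Suc ?k" r x] assms(2) by simp
  then have "\<not> int p dvd u"
    by (metis u dvd_refl mult_dvd_mono power_Suc2)
  then have "coprime u (int p ^ r)"
    using assms(1) prime_imp_coprime[of "int p" u] by (simp add: coprime_commute)
  with u that show thesis by blast
qed

text \<open>If \<open>x\<close> and \<open>y\<close> are the same power of \<open>p\<close> times
  units \<open>u\<close> and \<open>w\<close>, the multiplier is \<open>w\<close> times an inverse
  \<open>v\<close> of \<open>u\<close>.\<close>

lemma res_val_eq_imp_unit_multiple:
  assumes "prime p" "res_val p r x = res_val p r y" "res_val p r x < r"
  obtains \<tau> where "coprime \<tau> (int p ^ r)" "[y = \<tau> * x] (mod int p ^ r)"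
proof -
  obtain u where u: "x = int p ^ res_val p r x * u" "coprime u (int p ^ r)"
    using res_val_less_decompose[OF assms(1,3)] .
  obtain w where w: "y = int p ^ res_val p r x * w" "coprime w (int p ^ r)"
    using res_val_less_decompose[of p r y] assms by metis
  obtain v where v: "[u * v = 1] (mod int p ^ r)"
    using cong_solve_coprime_int[OF u(2)] by blast
  have "coprime v (int p ^ r)"
    using v by (metis coprime_iff_invertible_int mult.commute)
  then have "coprime (w * v) (int p ^ r)"
    using w(2) by auto
  moreover have "[y * 1 = y * (u * v)] (mod int p ^ r)"
    using v by (intro cong_scalar_left) (rule cong_sym)
  moreover have "y * (u * v) = w * v * x"
    by (subst u(1), subst w(1)) (simp add: algebra_simps)
  ultimately show thesis
    using that[of "w * v"] by (simp only: mult_1_right)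
qed

text \<open>The divisors \<open>p^k\<close> with \<open>k \<le> r\<close> determine
  \<open>res_val\<close>, and a factor coprime to \<open>p^r\<close> cancels from divisibility by
  each of them.\<close>

lemma res_val_unit_multiple:
  assumes "prime p" "coprime \<tau> (int p ^ r)"
  shows "res_val p r (\<tau> * x) = res_val p r x"
proof -
  have "k \<le> res_val p r (\<tau> * x) \<longleftrightarrow> k \<le> res_val p r x" if "k \<le> r" for k
  proof -
    have "coprime (int p ^ k) \<tau>"
      using assms(2) that by (metis coprime_commute coprime_divisors dvd_refl le_imp_power_dvd)
    then have "int p ^ k dvd \<tau> * x \<longleftrightarrow> int p ^ k dvd x"
      by (rule coprime_dvd_mult_right_iff)
    then show ?thesis
      using dvd_iff_le_res_val[OF assms(1) that] by blast
  qed
  then show ?thesis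
    using res_val_le by (metis order_antisym order_refl)
qed

text \<open>The ultrametric equality: \<open>p^b\<close> and \<open>p^(b+1)\<close> both divide
  \<open>y\<close>, so subtracting \<open>y\<close> does not change whether they divide
  \<open>x\<close>, and these two exponents pin the valuation.\<close>

lemma res_val_diff_eq:
  assumes "prime p" "res_val p r x < res_val p r y"
  shows "res_val p r (x - y) = res_val p r x"
proof -
  let ?b = "res_val p r x"
  note iff = dvd_iff_le_res_val[OF assms(1)]
  have b: "Suc ?b \<le> r"
    using assms(2) res_val_le[of p r y] by simp
  have "int p ^ Suc ?b dvd y"
    using iff[OF b] assms(2) by simp
  moreover have "int p ^ ?b dvd y"
    using iff[of ?b r y] assms(2) b by simp
  ultimately have "int p ^ Suc ?b dvd x - y \<longleftrightarrow> int p ^ Suc ?b dvd x"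
    "int p ^ ?b dvd x - y \<longleftrightarrow> int p ^ ?b dvd x"
    by (simp_all only: dvd_diff_left_iff)
  then have "Suc ?b \<le> res_val p r (x - y) \<longleftrightarrow> Suc ?b \<le> ?b" "?b \<le> res_val p r (x - y) \<longleftrightarrow> ?b \<le> ?b"
    using iff[OF b] iff[of ?b r] b by auto
  then show ?thesis by simp
qed

text \<open>The ideals of the integers mod \<open>p^r\<close> form a chain, so the valuation alone
  decides divisibility there. This solves for \<open>k\<close> in the conjugation equation.\<close>

lemma res_val_le_imp_multiple:
  assumes "prime p" "res_val p r x \<le> res_val p r y"
  obtains k where "[y = x * k] (mod int p ^ r)"
proof (cases "res_val p r x < r")
  case True
  then obtain u where u: "x = int p ^ res_val p r x * u" "coprime u (int p ^ r)"
    using res_val_less_decompose[OF assms(1)] by blast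
  obtain w where w: "y = int p ^ res_val p r x * w"
    using dvd_iff_le_res_val[OF assms(1), of "res_val p r x" r y] assms(2) True
    by (auto elim: dvdE)
  obtain v where v: "[u * v = 1] (mod int p ^ r)"
    using cong_solve_coprime_int[OF u(2)] by blast
  have "[y * 1 = y * (u * v)] (mod int p ^ r)"
    using v by (intro cong_scalar_left) (rule cong_sym)
  moreover have "y * (u * v) = x * (v * w)"
    by (subst u(1), subst w) (simp add: algebra_simps)
  ultimately show thesis
    using that by simp
next
  case False
  \<comment> \<open>Valuation \<open>r\<close> means that both residues vanish, so the multiplier 0
    serves.\<close>
  then have "r \<le> res_val p r y"
    using assms(2) by simp
  then have "[y = x * 0] (mod int p ^ r)"
    using dvd_iff_le_res_val[OF assms(1), of r r y] by (simp add: cong_0_iff)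
  then show thesis by (rule that)
qed

theorem theorem3p4:
  fixes p r \<alpha> \<beta> :: nat and i \<sigma> :: int
  assumes "prime p" and "odd p" and "r \<ge> 1"
    and "(i, \<sigma>) \<in> carrier (K (int p ^ r))"
    and "\<alpha> = res_val p r (\<sigma> \<ominus>\<^bsub>residue_ring (int p ^ r)\<^esub> \<one>\<^bsub>residue_ring (int p ^ r)\<^esub>)"
    and "\<beta> = res_val p r i"
  shows "conjugacy_class (K (int p ^ r)) (i, \<sigma>) =
    (if \<beta> < \<alpha>
     then {(j, \<sigma>) | j. j \<in> carrier (residue_ring (int p ^ r)) \<and> res_val p r j = \<beta>}
     else {(j, \<sigma>) | j. j \<in> carrier (residue_ring (int p ^ r)) \<and> res_val p r j \<ge> \<alpha>})"
proof -
  let ?n = "int p ^ r"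
  note p = \<open>prime p\<close> and iff = dvd_iff_le_res_val[OF \<open>prime p\<close>]
  have n: "?n > 1"
    using prime_gt_1_nat[OF p] \<open>r \<ge> 1\<close> by (intro one_less_power) auto
  interpret residues ?n "residue_ring ?n"
    by unfold_locales (use n in auto)
  \<comment> \<open>Ring subtraction is traded for integer subtraction, since \<open>res_val\<close>
    depends only on the residue class.\<close>
  have "\<sigma> \<ominus>\<^bsub>residue_ring ?n\<^esub> \<one>\<^bsub>residue_ring ?n\<^esub> = (\<sigma> - 1) mod ?n"
    by (simp add: a_minus_def res_neg_eq res_add_eq res_one_eq mod_simps)
  then have \<alpha>: "\<alpha> = res_val p r (\<sigma> - 1)"
    using assms(5) res_val_cong[OF p, of "(\<sigma> - 1) mod ?n"] by simp
  have \<beta>_unit: "res_val p r (\<tau> * i) = \<beta>" if "coprime \<tau> ?n" for \<tau>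
    using res_val_unit_multiple[OF p that] assms(6) by simp
  have \<alpha>_mult: "\<alpha> \<le> res_val p r ((\<sigma> - 1) * k)" for k
    using iff[of \<alpha> r] \<alpha> res_val_le by (metis dvd_mult2 order_refl)
  have class_iff: "(\<exists>k \<tau>. coprime \<tau> ?n \<and> [j = \<tau> * i - (\<sigma> - 1) * k] (mod ?n)) \<longleftrightarrow>
      (if \<beta> < \<alpha> then res_val p r j = \<beta> else res_val p r j \<ge> \<alpha>)" (is "?L \<longleftrightarrow> ?R") for j
  proof
    assume ?L
    then obtain k \<tau> where \<tau>: "coprime \<tau> ?n" and c: "[j = \<tau> * i - (\<sigma> - 1) * k] (mod ?n)"
      by blast
    have j: "res_val p r j = res_val p r (\<tau> * i - (\<sigma> - 1) * k)"
      using res_val_cong[OF p c] .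
    show ?R
    \<comment> \<open>The term \<open>\<tau> * i\<close> has valuation exactly \<beta>, the other at
      least \<alpha>. If \<open>\<beta> < \<alpha>\<close> the first dominates; otherwise both lie
      in the ideal of \<open>p^\<alpha>\<close>.\<close>
    proof (cases "\<beta> < \<alpha>")
      case True
      then show ?thesis
        using j res_val_diff_eq[OF p, of r "\<tau> * i" "(\<sigma> - 1) * k"] \<beta>_unit[OF \<tau>] \<alpha>_mult[of k]
        by simp
    next
      case False
      have le: "\<alpha> \<le> r"
        using \<alpha> res_val_le by simp
      have "int p ^ \<alpha> dvd \<tau> * i - (\<sigma> - 1) * k"
        using False \<beta>_unit[OF \<tau>] \<alpha>_mult[of k] iff[OF le] by (intro dvd_diff) auto
      then show ?thesis
        using False j iff[OF le] by simp
    qed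
  next
    assume R: ?R
    show ?L
    proof (cases "\<beta> < \<alpha>")
      case True
      then have "res_val p r i < r"
        using \<alpha> res_val_le[of p r "\<sigma> - 1"] assms(6) by simp
      then obtain \<tau> where "coprime \<tau> ?n" "[j = \<tau> * i] (mod ?n)"
        using res_val_eq_imp_unit_multiple[OF p, of r i j] R True assms(6) by auto
      then have "coprime \<tau> ?n \<and> [j = \<tau> * i - (\<sigma> - 1) * 0] (mod ?n)"
        by simp
      then show ?thesis by blast
    next
      case False
      have le: "\<alpha> \<le> r"
        using \<alpha> res_val_le by simp
      \<comment> \<open>With \<open>\<tau> = 1\<close> the equation to solve is
        \<open>(\<sigma> - 1) * k = i - j\<close> mod \<open>p^r\<close>; it is solvable because
        \<open>i\<close> and \<open>j\<close> both lie in the ideal of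
        \<open>p^\<alpha>\<close>.\<close>
      have "int p ^ \<alpha> dvd i - j"
        using False R assms(6) iff[OF le] by (intro dvd_diff) auto
      then have "res_val p r (\<sigma> - 1) \<le> res_val p r (i - j)"
        using iff[OF le] \<alpha> by simp
      then obtain k where "[i - j = (\<sigma> - 1) * k] (mod ?n)"
        using res_val_le_imp_multiple[OF p] by blast
      then have "[i - (i - j) = i - (\<sigma> - 1) * k] (mod ?n)"
        by (intro cong_diff cong_refl)
      then have "coprime 1 ?n \<and> [j = 1 * i - (\<sigma> - 1) * k] (mod ?n)"
        by simp
      then show ?thesis by blast
    qed
  qed
  have "(j, \<rho>) \<in> conjugacy_class (K ?n) (i, \<sigma>) \<longleftrightarrow>
      \<rho> = \<sigma> \<and> j \<in> carrier (residue_ring ?n) \<and>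
      (if \<beta> < \<alpha> then res_val p r j = \<beta> else res_val p r j \<ge> \<alpha>)" for j \<rho>
    unfolding mem_conjugacy_class_K_iff[OF n assms(4)] class_iff res_carrier_eq ..
  then show ?thesis by auto
qed

end
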